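(* Let $I\subseteq\mathbb{R}$ be an interval with interior $I^\circ$, let $a,b\in I^\circ$ with $a<b$, and let $g:[a,b]\to\mathbb{R}$ be an integrable function on $[a,b]$. For $t\in[0,1]$ put $$M(t)=\int_t^1 g\big(sa+(1-s)b\big)\,ds-\int_0^t g\big(sa+(1-s)b\big)\,ds.$$ Then: (i) If $g$ is symmetric to $\frac{a+b}{2}$, then $M(t)=2\int_t^{1/2} g\big(sa+(1-s)b\big)\,ds$ for $0\le t\le\frac12$, and $M(t)=-2\int_{1/2}^{t} g\big(sa+(1-s)b\big)\,ds$ for $\frac12\le t\le 1$. (ii) For any $t\in[0,1]$, $M(t)+M(1-t)=0$. (iii) If $g$ is a nonnegative function, then $M(t)\ge 0$ for $0\le t\le\frac12$ and $M(t)\le 0$ for $\frac12\le t\le 1$. (iv) The following inequalities hold: $$\int_0^1|M(t)|\,dt\le\frac12\|g\|_\infty,$$ and $$\int_0^1|M(t)|\,dt\le 2\|g\|_q\int_0^1\Big|t-\frac12\Big|^{1/p}dt.$$ (v) Let $f:I^\circ\to\mathbb{R}$ be a differentiable mapping on $I^\circ$, and let $g$ be a differentiable nonnegative mapping. If $f'\in L[a,b]$, then $$\frac{1}{b-a}\left(\frac{f(a)+f(b)}{2}\int_a^b g(x)\,dx-\int_a^b f(x)g(x)\,dx\right)=\frac{b-a}{2}\int_0^1 M(t)f'\big(ta+(1-t)b\big)\,dt.$$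
   Context: A function $g:[a,b]\to\mathbb{R}$ is symmetric to $\frac{a+b}{2}$ if $g(x)=g(a+b-x)$ for all $x\in[a,b]$. $L[a,b]$ denotes the set of integrable functions on $[a,b]$. $\|g\|_\infty$ and $\|g\|_q$ denote the supremum norm and the $L^q$-norm of $g$ on $[a,b]$, and $p,q>1$ are conjugate exponents, $\frac1p+\frac1q=1$, as in Hölder's inequality.
   Formalization: Parts (ii) and (iii) assume g symmetric to (a+b)/2, as they fail for g(x)=x on [0,1]; the second bound in (iv) carries an extra factor (b-a)^(-1/q) and is stated as printed only for b-a≥1, as it fails for g=1 on short intervals. *)

theory Defs
  imports "HOL-Analysis.Analysis"
begin

definition symmetric_mid :: "real \<Rightarrow> real \<Rightarrow> (real \<Rightarrow> real) \<Rightarrow> bool" where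
  "symmetric_mid a b g \<longleftrightarrow> (\<forall>x\<in>{a..b}. g x = g (a + b - x))"

definition M_fun :: "(real \<Rightarrow> real) \<Rightarrow> real \<Rightarrow> real \<Rightarrow> real \<Rightarrow> real" where
  "M_fun g a b t =
     (LINT s:{t..1}|lebesgue. g (s * a + (1 - s) * b)) -
     (LINT s:{0..t}|lebesgue. g (s * a + (1 - s) * b))"

(* The norms take values in the extended nonnegative reals, so that they are
   infinite, rather than a default value, for functions outside the space. *)

definition sup_norm_on :: "real \<Rightarrow> real \<Rightarrow> (real \<Rightarrow> real) \<Rightarrow> ennreal" where
  "sup_norm_on a b g = (SUP x\<in>{a..b}. ennreal \<bar>g x\<bar>)"

definition Lq_norm_on :: "real \<Rightarrow> real \<Rightarrow> real \<Rightarrow> (real \<Rightarrow> real) \<Rightarrow> ennreal" where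
  "Lq_norm_on q a b g =
     (let J = (\<integral>\<^sup>+x\<in>{a..b}. ennreal (\<bar>g x\<bar> powr q) \<partial>lebesgue)
      in if J = \<infinity> then \<infinity> else ennreal (enn2real J powr (1 / q)))"

end

theory Submission
  imports Defs
begin

text \<open>
Put \<open>h s = g (s * a + (1 - s) * b)\<close> on the unit interval, so that \<open>M t\<close> is the integral of \<open>h\<close> to the
right of \<open>t\<close> minus the integral of \<open>h\<close> to the left of \<open>t\<close>. With \<open>H\<close> the total integral of \<open>h\<close>,
everything follows from \<open>M t = H - 2 * integral {0..t} h\<close>.

If \<open>g\<close> is symmetric about the midpoint, then \<open>h (1 - s) = h s\<close>; hence \<open>H\<close> is twice the integral over
the first half, and the formulas for \<open>M\<close>, its antisymmetry and its sign are immediate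
(\<open>imbalance_symmetric\<close>).

For the two bounds on the integral of \<open>\<bar>M\<bar>\<close> no symmetry of \<open>g\<close> is available. However, as
\<open>M 1 = - M 0\<close>, the continuous function \<open>M\<close> vanishes at some \<open>z\<close>, and it extends antiperiodically to
the line, so \<open>\<bar>M\<bar>\<close> lives on the circle of length 1. Going from \<open>z\<close> to \<open>t\<close> along the shorter arc \<open>S\<close>
changes \<open>M\<close> by at most twice the integral of \<open>\<bar>h\<bar>\<close> over \<open>S\<close>, and the measure of \<open>S\<close> is the
distance from \<open>z\<close> to \<open>t\<close> on the circle (\<open>imbalance_le_integral\<close>). A supremum bound or Hoelder's
inequality on \<open>S\<close> bounds \<open>\<bar>M t\<bar>\<close> by a constant times a power of that distance. The
integral of such a power over the circle is the same for all \<open>z\<close>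
(\<open>has_integral_circle_dist_powr\<close>), and for \<open>z = 1/2\<close> the distance is \<open>\<bar>t - 1/2\<bar>\<close>. The factor
\<open>(b - a) powr (- 1 / q)\<close> is the change of the \<open>q\<close>-norm when \<open>{a..b}\<close> is rescaled to the unit interval.

The last identity is integration by parts against \<open>\<phi> t = f (t * a + (1 - t) * b)\<close>, using
\<open>M' = - 2 * h\<close> for continuous \<open>h\<close> (\<open>integral_imbalance_by_parts\<close>).
\<close>

section \<open>The difference of the two partial integrals\<close>

definition imbalance :: "(real \<Rightarrow> real) \<Rightarrow> real \<Rightarrow> real" where
  "imbalance h t = integral {t..1} h - integral {0..t} h"

lemma imbalance_eq:
  assumes "h integrable_on {0..1}" "t \<in> {0..1}"
  shows "imbalance h t = integral {0..1} h - 2 * integral {0..t} h"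
  using Henstock_Kurzweil_Integration.integral_combine[of 0 t 1 h] assms
  by (simp add: imbalance_def)

lemma continuous_on_imbalance:
  assumes "h integrable_on {0..1}"
  shows "continuous_on {0..1} (imbalance h)"
proof -
  have "continuous_on {0..1} (\<lambda>t. integral {0..1} h - 2 * integral {0..t} h)"
    by (intro continuous_intros indefinite_integral_continuous_1 assms)
  then show ?thesis
    by (rule continuous_on_eq) (simp add: imbalance_eq assms)
qed

lemma has_real_derivative_imbalance:
  assumes "continuous_on {0..1} h" "t \<in> {0..1}"
  shows "(imbalance h has_real_derivative - 2 * h t) (at t within {0..1})"
proof -
  have "h integrable_on {0..1}"
    using assms by (simp add: integrable_continuous_real)
  moreover have "((\<lambda>t. integral {0..1} h - 2 * integral {0..t} h)
          has_real_derivative - 2 * h t) (at t within {0..1})"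
    using integral_has_real_derivative[OF assms] by (auto intro!: derivative_eq_intros)
  ultimately show ?thesis
    using assms(2) by (elim has_field_derivative_transform_within[where d=1])
      (auto simp: imbalance_eq)
qed

section \<open>Affine substitutions on the unit interval\<close>

lemma has_integral_unit_reflect:
  fixes f :: "real \<Rightarrow> real"
  assumes "(f has_integral i) {u..v}"
  shows "((\<lambda>s. f (1 - s)) has_integral i) {1 - v..1 - u}"
proof -
  have "(\<lambda>x::real. 1 - x) ` {u..v} = {1 - v..1 - u}"
    by simp
  then show ?thesis
    using has_integral_affinity[of f i u v "-1" 1] assms by (simp add: cbox_interval algebra_simps)
qed

lemma has_integral_unit_segment:
  fixes f :: "real \<Rightarrow> real"
  assumes "a < b" "(f has_integral i) {a..b}"
  shows "((\<lambda>s. f (s * a + (1 - s) * b)) has_integral i / (b - a)) {0..1}"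
proof -
  have "(\<lambda>x. 1 / (a - b) * x + - (1 / (a - b) * b)) ` {a..b} = {0..1}"
  proof -
    have "(\<lambda>x. 1 / (a - b) * x + - (1 / (a - b) * b)) ` {a..b}
        = {1 / (a - b) * b + - (1 / (a - b) * b)..1 / (a - b) * a + - (1 / (a - b) * b)}"
      using assms(1) by (subst image_affinity_atLeastAtMost) auto
    moreover have "1 / (a - b) * a + - (1 / (a - b) * b) = 1"
      using assms(1) by (simp flip: diff_divide_distrib)
    ultimately show ?thesis by simp
  qed
  moreover have "(\<lambda>x. f ((a - b) * x + b)) = (\<lambda>s. f (s * a + (1 - s) * b))"
    by (simp add: algebra_simps)
  moreover have "1 / \<bar>a - b\<bar> * i = i / (b - a)"
    using assms(1) by (simp add: field_simps)
  ultimately show ?thesis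
    using has_integral_affinity[of f i a b "a - b" b] assms by (simp add: cbox_interval)
qed

lemma absolutely_integrable_unit_segment:
  fixes f :: "real \<Rightarrow> real"
  assumes "a < b" "f absolutely_integrable_on {a..b}"
  shows "(\<lambda>s. f (s * a + (1 - s) * b)) absolutely_integrable_on {0..1}"
  using assms has_integral_unit_segment[of a b f] has_integral_unit_segment[of a b "\<lambda>x. norm (f x)"]
  unfolding absolutely_integrable_on_def integrable_on_def by blast

section \<open>Symmetric functions\<close>

lemma integral_unit_symmetric:
  fixes h :: "real \<Rightarrow> real"
  assumes "h integrable_on {0..1}" "\<And>s. s \<in> {0..1} \<Longrightarrow> h (1 - s) = h s" "t \<in> {0..1}"
  shows "integral {0..1 - t} h = integral {0..1} h - integral {0..t} h"
proof -
  have "h integrable_on {0..t}"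
    by (rule integrable_on_subinterval[OF assms(1)]) (use assms(3) in auto)
  then have "((\<lambda>s. h (1 - s)) has_integral integral {0..t} h) {1 - t..1}"
    using has_integral_unit_reflect[of h _ 0 t] by (simp add: has_integral_integral)
  then have "(h has_integral integral {0..t} h) {1 - t..1}"
    by (rule has_integral_eq[rotated]) (use assms in auto)
  then show ?thesis
    using Henstock_Kurzweil_Integration.integral_combine[of 0 "1 - t" 1 h] assms
    by (simp add: integral_unique)
qed

lemma imbalance_symmetric:
  fixes h :: "real \<Rightarrow> real"
  assumes h: "h integrable_on {0..1}" and sym: "\<And>s. s \<in> {0..1} \<Longrightarrow> h (1 - s) = h s"
  shows "t \<in> {0..1/2} \<Longrightarrow> imbalance h t = 2 * integral {t..1/2} h"
    and "t \<in> {1/2..1} \<Longrightarrow> imbalance h t = - 2 * integral {1/2..t} h"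
    and "t \<in> {0..1} \<Longrightarrow> imbalance h t + imbalance h (1 - t) = 0"
proof -
  have half: "integral {0..1} h = 2 * integral {0..1/2} h"
    using integral_unit_symmetric[OF h sym, of "1/2"] by simp
  show "imbalance h t = 2 * integral {t..1/2} h" if "t \<in> {0..1/2}"
  proof -
    have "h integrable_on {0..1/2}"
      by (rule integrable_on_subinterval[OF h]) auto
    then show ?thesis
      using Henstock_Kurzweil_Integration.integral_combine[of 0 t "1/2" h] that imbalance_eq[OF h, of t] half by auto
  qed
  show "imbalance h t = - 2 * integral {1/2..t} h" if "t \<in> {1/2..1}"
  proof -
    have "h integrable_on {0..t}"
      by (rule integrable_on_subinterval[OF h]) (use that in auto)
    then show ?thesis
      using Henstock_Kurzweil_Integration.integral_combine[of 0 "1/2" t h] that imbalance_eq[OF h, of t] half by auto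
  qed
  show "imbalance h t + imbalance h (1 - t) = 0" if "t \<in> {0..1}"
    using integral_unit_symmetric[OF h sym that] that imbalance_eq[OF h, of t] imbalance_eq[OF h, of "1 - t"]
    by auto
qed

section \<open>The pointwise bound by an integral over an arc\<close>

text \<open>The values at the two ends are opposite, so the intermediate value theorem applies.\<close>

lemma imbalance_zero:
  assumes "h integrable_on {0..1}"
  obtains z where "z \<in> {0..1}" "imbalance h z = 0"
proof -
  have ends: "imbalance h 1 = - imbalance h 0"
    by (simp add: imbalance_def)
  note c = continuous_on_imbalance[OF assms]
  have "\<exists>z\<ge>0. z \<le> 1 \<and> imbalance h z = 0"
  proof (cases "imbalance h 0 \<le> 0")
    case True
    then show ?thesis using IVT'[of "imbalance h" 0 0 1] c ends by auto
  next
    case False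
    then show ?thesis using IVT2'[of "imbalance h" 1 0 0] c ends by auto
  qed
  then show ?thesis using that by auto
qed

text \<open>For points of \<open>{0..1}\<close> this is the arc distance on the circle obtained by gluing 0 to 1.\<close>

definition circle_dist :: "real \<Rightarrow> real \<Rightarrow> real" where
  "circle_dist z t = min \<bar>t - z\<bar> (1 - \<bar>t - z\<bar>)"

text \<open>
Let \<open>u \<le> v\<close> be the points \<open>t\<close> and \<open>z\<close> in increasing order. Since the imbalance vanishes at \<open>z\<close>, its
absolute value at \<open>t\<close> is that of the difference of its values at \<open>u\<close> and \<open>v\<close>, which up to sign is twice
the integral of \<open>h\<close> over \<open>{u..v}\<close>. It is equally that of the sum of these values, which is twice the
difference of the integrals over the two outer pieces. Choosing the shorter of the two arcs gives \<open>S\<close>.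
\<close>

lemma imbalance_le_integral:
  fixes h :: "real \<Rightarrow> real"
  assumes h: "h absolutely_integrable_on {0..1}"
    and z: "z \<in> {0..1}" "imbalance h z = 0" and t: "t \<in> {0..1}"
  obtains S where "S \<in> lmeasurable" "S \<subseteq> {0..1}" "measure lebesgue S = circle_dist z t"
    "\<bar>imbalance h t\<bar> \<le> 2 * integral S (\<lambda>s. \<bar>h s\<bar>)"
proof -
  define u where "u = min t z"
  define v where "v = max t z"
  have uv: "0 \<le> u" "u \<le> v" "v \<le> 1" "\<bar>t - z\<bar> = v - u"
    using z t by (auto simp: u_def v_def)
  have hi: "h integrable_on {c..d}" "(\<lambda>s. \<bar>h s\<bar>) integrable_on {c..d}" if "0 \<le> c" "d \<le> 1" for c d
    using absolutely_integrable_on_subinterval[OF h, of c d] that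
    by (auto simp: absolutely_integrable_on_def)
  have le: "\<bar>integral {c..d} h\<bar> \<le> integral {c..d} (\<lambda>s. \<bar>h s\<bar>)" if "0 \<le> c" "d \<le> 1" for c d
    using integral_norm_bound_integral[OF hi(1)[OF that] hi(2)[OF that]] by auto
  have M: "imbalance h s = integral {0..1} h - 2 * integral {0..s} h" if "s \<in> {0..1}" for s
    using imbalance_eq hi(1) that by simp
  have abs: "\<bar>imbalance h t\<bar> = \<bar>imbalance h v - imbalance h u\<bar>"
    "\<bar>imbalance h t\<bar> = \<bar>imbalance h v + imbalance h u\<bar>"
    using z by (auto simp: u_def v_def min_def max_def)
  have split: "integral {0..1} h = integral {0..u} h + integral {u..v} h + integral {v..1} h"
    "integral {0..v} h = integral {0..u} h + integral {u..v} h"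
    using Henstock_Kurzweil_Integration.integral_combine[of 0 u v h]
      Henstock_Kurzweil_Integration.integral_combine[of 0 v 1 h] uv hi(1) by auto
  show ?thesis
  proof (cases "v - u \<le> 1/2")
    case True
    have "\<bar>imbalance h t\<bar> \<le> 2 * integral {u..v} (\<lambda>s. \<bar>h s\<bar>)"
      using le[of u v] abs(1) M[of u] M[of v] split uv by auto
    moreover have "measure lebesgue {u..v} = circle_dist z t"
      using True uv by (simp add: circle_dist_def)
    ultimately show ?thesis
      using that[of "{u..v}"] uv by auto
  next
    case False
    let ?S = "{0..u} \<union> {v..1}"
    have disj: "{0..u} \<inter> {v..1} = {}"
      using False by auto
    have "integral ?S (\<lambda>s. \<bar>h s\<bar>) = integral {0..u} (\<lambda>s. \<bar>h s\<bar>) + integral {v..1} (\<lambda>s. \<bar>h s\<bar>)"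
      by (rule integral_Un) (use hi uv disj in auto)
    then have "\<bar>imbalance h t\<bar> \<le> 2 * integral ?S (\<lambda>s. \<bar>h s\<bar>)"
      using le[of 0 u] le[of v 1] abs(2) M[of u] M[of v] split uv by auto
    moreover have "measure lebesgue ?S = circle_dist z t"
      using False uv disj by (subst measure_Un_AE) (auto simp: circle_dist_def)
    ultimately show ?thesis
      using that[of ?S] uv by auto
  qed
qed

section \<open>Hoelder's inequality on a set of finite measure\<close>

text \<open>
This is Hoelder's inequality against the constant 1: apply Young's inequality to the two factors,
scaled to have norm at most 1, and integrate.
\<close>

lemma Holder_inequality_lmeasurable:
  fixes h :: "real \<Rightarrow> real"
  assumes pq: "p > 1" "q > 1" "1 / p + 1 / q = 1" and S: "S \<in> lmeasurable"
    and h: "(\<lambda>s. \<bar>h s\<bar>) integrable_on S" "(\<lambda>s. \<bar>h s\<bar> powr q) integrable_on S"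
  shows "integral S (\<lambda>s. \<bar>h s\<bar>)
    \<le> measure lebesgue S powr (1 / p) * integral S (\<lambda>s. \<bar>h s\<bar> powr q) powr (1 / q)"
proof (cases "measure lebesgue S = 0")
  case True
  then have "negligible S"
    using S by (simp add: negligible_iff_measure)
  then show ?thesis by (simp add: integral_negligible)
next
  case False
  define m where "m = measure lebesgue S"
  define J where "J = integral S (\<lambda>s. \<bar>h s\<bar> powr q)"
  have m: "m > 0" using False by (simp add: m_def zero_less_measure_iff)
  have J: "J \<ge> 0" unfolding J_def by (rule integral_nonneg[OF h(2)]) auto
  \<comment> \<open>Scaling by an upper bound \<open>e > 0\<close> of the \<open>q\<close>-norm, and not by the norm itself, also covers the case
    of norm 0, in which \<open>e\<close> tends to 0.\<close>
  have bound: "integral S (\<lambda>s. \<bar>h s\<bar>) \<le> m powr (1 / p) * e" if e: "e > 0" "J \<le> e powr q" for e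
  proof -
    define k where "k = m powr (1 / p) * e"
    have k: "k > 0" using m e by (simp add: k_def)
    have "\<bar>h s\<bar> / k \<le> e powr - q / q * \<bar>h s\<bar> powr q + 1 / (m * p)" for s
    proof -
      have "\<bar>h s\<bar> / k = (m powr (- 1 / p)) * (\<bar>h s\<bar> / e)"
        by (simp add: k_def powr_minus field_simps)
      also have "\<dots> \<le> (m powr (- 1 / p)) powr p / p + (\<bar>h s\<bar> / e) powr q / q"
        by (rule Youngs_inequality) (use pq e in auto)
      also have "(m powr (- 1 / p)) powr p = 1 / m"
        using pq m by (subst powr_powr) (simp add: powr_minus_divide)
      also have "(\<bar>h s\<bar> / e) powr q = e powr - q * \<bar>h s\<bar> powr q"
        using e by (simp add: powr_divide powr_minus field_simps)
      finally show ?thesis by (simp add: field_simps)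
    qed
    then have "integral S (\<lambda>s. \<bar>h s\<bar> / k)
        \<le> integral S (\<lambda>s. e powr - q / q * \<bar>h s\<bar> powr q + 1 / (m * p))"
      using h S by (intro integral_le integrable_add integrable_on_const
          integrable_on_divide integrable_on_mult_right) auto
    also have "\<dots> = e powr - q / q * J + m * (1 / (m * p))"
    proof -
      have "integral S (\<lambda>s. e powr - q / q * \<bar>h s\<bar> powr q + 1 / (m * p))
          = integral S (\<lambda>s. e powr - q / q * \<bar>h s\<bar> powr q) + integral S (\<lambda>s. 1 / (m * p) * 1)"
        using h(2) S by (subst integral_add [symmetric])
          (auto intro!: integrable_on_mult_right integrable_on_const simp del: times_divide_eq_left)
      then show ?thesis
        unfolding integral_mult_right using S by (simp add: J_def m_def lmeasure_integral)
    qed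
    also have "\<dots> \<le> e powr - q / q * e powr q + m * (1 / (m * p))"
      using e pq by (intro add_right_mono mult_left_mono) auto
    also have "\<dots> = 1"
      using e m pq by (simp add: powr_minus field_simps)
    finally show ?thesis
      using k by (simp add: k_def field_simps)
  qed
  have "integral S (\<lambda>s. \<bar>h s\<bar>) \<le> m powr (1 / p) * J powr (1 / q)"
  proof (cases "J = 0")
    case True
    have "integral S (\<lambda>s. \<bar>h s\<bar>) / m powr (1 / p) \<le> e" if "e > 0" for e
      using bound[of e] that True m by (simp add: field_simps)
    then have "integral S (\<lambda>s. \<bar>h s\<bar>) / m powr (1 / p) \<le> 0"
      by (meson field_le_epsilon add_0 dense_ge)
    then show ?thesis
      using m True by (simp add: field_simps)
  next
    case False
    then show ?thesis
      using bound[of "J powr (1 / q)"] J pq by (simp add: powr_powr)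
  qed
  then show ?thesis by (simp add: m_def J_def)
qed

section \<open>Integrating powers of the distance on the circle\<close>

lemma has_integral_powr_shift:
  fixes c r u v :: real
  assumes "0 \<le> r" "0 \<le> u" "u \<le> v"
  shows "((\<lambda>t. (t - c) powr r) has_integral (v powr (r + 1) - u powr (r + 1)) / (r + 1)) {c + u..c + v}"
    and "((\<lambda>t. (c - t) powr r) has_integral (v powr (r + 1) - u powr (r + 1)) / (r + 1)) {c - v..c - u}"
proof -
  have "((\<lambda>t. (t - c) powr r) has_integral
      (c + v - c) powr (r + 1) / (r + 1) - (c + u - c) powr (r + 1) / (r + 1)) {c + u..c + v}"
    by (rule fundamental_theorem_of_calculus_interior)
      (use assms in \<open>auto intro!: continuous_intros continuous_on_powr' derivative_eq_intros
          simp: has_real_derivative_iff_has_vector_derivative[symmetric]\<close>)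
  then show "((\<lambda>t. (t - c) powr r) has_integral (v powr (r + 1) - u powr (r + 1)) / (r + 1)) {c + u..c + v}"
    by (simp add: diff_divide_distrib)
  have "((\<lambda>t. (c - t) powr r) has_integral
      - ((c - (c - u)) powr (r + 1) / (r + 1)) - - ((c - (c - v)) powr (r + 1) / (r + 1))) {c - v..c - u}"
    by (rule fundamental_theorem_of_calculus_interior)
      (use assms in \<open>auto intro!: continuous_intros continuous_on_powr' derivative_eq_intros
          simp: has_real_derivative_iff_has_vector_derivative[symmetric]\<close>)
  then show "((\<lambda>t. (c - t) powr r) has_integral (v powr (r + 1) - u powr (r + 1)) / (r + 1)) {c - v..c - u}"
    by (simp add: diff_divide_distrib)
qed

text \<open>
The value does not depend on \<open>z\<close>, as the circle is homogeneous. For \<open>z \<le> 1/2\<close> the distance is linear on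
each of the three pieces cut off by \<open>z\<close> and its antipode \<open>z + 1/2\<close>; the reflection \<open>t \<mapsto> 1 - t\<close> reduces
the other half to this one.
\<close>

lemma has_integral_circle_dist_powr:
  fixes r z :: real
  assumes r: "0 \<le> r" and z: "z \<in> {0..1}"
  shows "((\<lambda>t. circle_dist z t powr r) has_integral (1 / 2) powr r / (r + 1)) {0..1}"
proof -
  have left: "((\<lambda>t. circle_dist z t powr r) has_integral (1 / 2) powr r / (r + 1)) {0..1}"
    if z: "0 \<le> z" "z \<le> 1/2" for z
  proof -
    let ?f = "\<lambda>t. circle_dist z t powr r"
    let ?G = "\<lambda>x::real. x powr (r + 1)"
    have half: "(0::real) \<le> 1/2"
      by simp
    have ends: "1 + z - 1/2 = z + 1/2" "1 + z - z = 1"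
      by simp_all
    have 1: "(?f has_integral (?G z - ?G 0) / (r + 1)) {0..z}"
      using has_integral_powr_shift(2)[OF r order_refl z(1), of z] z
      unfolding diff_self diff_0_right by (elim has_integral_eq[rotated]) (auto simp: circle_dist_def)
    have 2: "(?f has_integral (?G (1/2) - ?G 0) / (r + 1)) {z..z + 1/2}"
      using has_integral_powr_shift(1)[OF r order_refl half, of z] z
      unfolding add_0_right by (elim has_integral_eq[rotated]) (auto simp: circle_dist_def)
    have 3: "(?f has_integral (?G (1/2) - ?G z) / (r + 1)) {z + 1/2..1}"
      using has_integral_powr_shift(2)[OF r z, of "1 + z"] z
      unfolding ends by (elim has_integral_eq[rotated]) (auto simp: circle_dist_def algebra_simps)
    have "(?f has_integral (?G z - ?G 0) / (r + 1) + (?G (1/2) - ?G 0) / (r + 1)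
        + (?G (1/2) - ?G z) / (r + 1)) {0..1}"
      using z by (intro has_integral_combine[OF _ _ has_integral_combine[OF _ _ 1 2] 3]) auto
    moreover have "(?G z - ?G 0) / (r + 1) + (?G (1/2) - ?G 0) / (r + 1)
        + (?G (1/2) - ?G z) / (r + 1) = (1 / 2) powr r / (r + 1)"
      unfolding add_divide_distrib[symmetric] using r by (simp add: powr_add)
    ultimately show ?thesis by simp
  qed
  show ?thesis
  proof (cases "z \<le> 1/2")
    case True
    then show ?thesis using left z by simp
  next
    case False
    then have "((\<lambda>t. circle_dist (1 - z) (1 - t) powr r) has_integral (1 / 2) powr r / (r + 1)) {0..1}"
      using has_integral_unit_reflect[OF left[of "1 - z"]] z by simp
    moreover have "circle_dist (1 - z) (1 - t) = circle_dist z t" for t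
      by (simp add: circle_dist_def abs_minus_commute)
    ultimately show ?thesis by simp
  qed
qed

lemma has_integral_abs_mid_powr:
  assumes "0 \<le> r"
  shows "((\<lambda>t. \<bar>t - 1/2\<bar> powr r) has_integral (1 / 2) powr r / (r + 1)) {0..1::real}"
  by (rule has_integral_eq[OF _ has_integral_circle_dist_powr[OF assms, of "1/2"]])
    (auto simp: circle_dist_def abs_if min_def)

section \<open>Bounds for the mean absolute imbalance\<close>

text \<open>
The common core of both norm estimates: \<open>r = 1\<close> is the supremum norm and \<open>r = 1 / p\<close> the \<open>q\<close>-norm.
\<close>

lemma integral_abs_imbalance_le:
  fixes h :: "real \<Rightarrow> real"
  assumes h: "h absolutely_integrable_on {0..1}" and r: "0 \<le> r"
    and S: "\<And>S. S \<in> lmeasurable \<Longrightarrow> S \<subseteq> {0..1} \<Longrightarrow>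
      integral S (\<lambda>s. \<bar>h s\<bar>) \<le> C * measure lebesgue S powr r"
  shows "integral {0..1} (\<lambda>t. \<bar>imbalance h t\<bar>) \<le> 2 * C * ((1 / 2) powr r / (r + 1))"
proof -
  have hi: "h integrable_on {0..1}"
    using h by (simp add: absolutely_integrable_on_def)
  obtain z where z: "z \<in> {0..1}" "imbalance h z = 0"
    using imbalance_zero[OF hi] by blast
  have "(\<lambda>t. \<bar>imbalance h t\<bar>) integrable_on {0..1}"
    by (intro integrable_continuous_real continuous_intros continuous_on_imbalance hi)
  then have *: "((\<lambda>t. \<bar>imbalance h t\<bar>) has_integral integral {0..1} (\<lambda>t. \<bar>imbalance h t\<bar>)) {0..1}"
    by (rule integrable_integral)
  have "((\<lambda>t. 2 * C * circle_dist z t powr r) has_integral 2 * C * ((1 / 2) powr r / (r + 1))) {0..1}"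
    by (intro has_integral_mult_right has_integral_circle_dist_powr r z)
  then show ?thesis
  proof (rule has_integral_le[OF *])
    fix t :: real assume "t \<in> {0..1}"
    then obtain S where "S \<in> lmeasurable" "S \<subseteq> {0..1}" "measure lebesgue S = circle_dist z t"
      "\<bar>imbalance h t\<bar> \<le> 2 * integral S (\<lambda>s. \<bar>h s\<bar>)"
      using imbalance_le_integral[OF h z] by blast
    then show "\<bar>imbalance h t\<bar> \<le> 2 * C * circle_dist z t powr r"
      using S[of S] by simp
  qed
qed

lemma integral_abs_imbalance_le_sup:
  fixes h :: "real \<Rightarrow> real"
  assumes h: "h absolutely_integrable_on {0..1}" and C: "\<And>s. s \<in> {0..1} \<Longrightarrow> \<bar>h s\<bar> \<le> C"
  shows "integral {0..1} (\<lambda>t. \<bar>imbalance h t\<bar>) \<le> 1 / 2 * C"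
proof -
  have "integral {0..1} (\<lambda>t. \<bar>imbalance h t\<bar>) \<le> 2 * C * ((1 / 2) powr 1 / (1 + 1))"
  proof (rule integral_abs_imbalance_le[OF h])
    fix S :: "real set" assume S: "S \<in> lmeasurable" "S \<subseteq> {0..1}"
    have "(\<lambda>s. \<bar>h s\<bar>) integrable_on S"
      using set_integrable_subset[OF h, of S] S by (auto simp: absolutely_integrable_on_def fmeasurableD)
    moreover have "integral S (\<lambda>s. C) = C * measure lebesgue S"
      using S integral_mult_right[of S C "\<lambda>s. 1"] by (simp add: lmeasure_integral)
    ultimately show "integral S (\<lambda>s. \<bar>h s\<bar>) \<le> C * measure lebesgue S powr 1"
      using integral_le[of "\<lambda>s. \<bar>h s\<bar>" S "\<lambda>s. C"] C S by (force simp: integrable_on_const)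
  qed auto
  then show ?thesis by simp
qed

lemma integral_abs_imbalance_le_Lq:
  fixes h :: "real \<Rightarrow> real"
  assumes h: "h absolutely_integrable_on {0..1}" and pq: "p > 1" "q > 1" "1 / p + 1 / q = 1"
    and J: "((\<lambda>s. \<bar>h s\<bar> powr q) has_integral J) {0..1}"
  shows "integral {0..1} (\<lambda>t. \<bar>imbalance h t\<bar>)
    \<le> 2 * J powr (1 / q) * integral {0..1} (\<lambda>t. \<bar>t - 1/2\<bar> powr (1 / p))"
proof -
  have Ja: "(\<lambda>s. \<bar>h s\<bar> powr q) absolutely_integrable_on {0..1}"
    using J by (auto simp: absolutely_integrable_on_def integrable_on_def)
  have "integral {0..1} (\<lambda>t. \<bar>imbalance h t\<bar>)
      \<le> 2 * J powr (1 / q) * ((1 / 2) powr (1 / p) / (1 / p + 1))"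
  proof (rule integral_abs_imbalance_le[OF h])
    fix S :: "real set" assume S: "S \<in> lmeasurable" "S \<subseteq> {0..1}"
    have i: "(\<lambda>s. \<bar>h s\<bar>) integrable_on S" "(\<lambda>s. \<bar>h s\<bar> powr q) integrable_on S"
      using set_integrable_subset[OF h, of S] set_integrable_subset[OF Ja, of S] S
      by (auto simp: absolutely_integrable_on_def fmeasurableD)
    have "integral S (\<lambda>s. \<bar>h s\<bar> powr q) \<le> J"
      by (rule has_integral_subset_le[OF S(2) integrable_integral[OF i(2)] J]) auto
    moreover have "0 \<le> integral S (\<lambda>s. \<bar>h s\<bar> powr q)"
      by (rule integral_nonneg[OF i(2)]) auto
    ultimately have "integral S (\<lambda>s. \<bar>h s\<bar> powr q) powr (1 / q) \<le> J powr (1 / q)"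
      using pq by (intro powr_mono2) auto
    then have "measure lebesgue S powr (1 / p) * integral S (\<lambda>s. \<bar>h s\<bar> powr q) powr (1 / q)
      \<le> measure lebesgue S powr (1 / p) * J powr (1 / q)"
      by (intro mult_left_mono) auto
    then show "integral S (\<lambda>s. \<bar>h s\<bar>) \<le> J powr (1 / q) * measure lebesgue S powr (1 / p)"
      using Holder_inequality_lmeasurable[OF pq S(1) i] by (simp add: mult.commute)
  qed (use pq in auto)
  then show ?thesis
    using has_integral_abs_mid_powr[of "1 / p"] pq by (simp add: integral_unique)
qed

section \<open>Integration by parts\<close>

text \<open>
As \<open>\<phi>'\<close> is only assumed to be integrable, the fundamental theorem of calculus is applied to the product
\<open>imbalance h t * \<phi> t\<close> in the Henstock-Kurzweil sense, where a derivative existing everywhere is enough.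
Both terms of its derivative are absolutely integrable, so that the integral can be split.
\<close>

lemma integral_imbalance_by_parts:
  fixes h \<phi> \<phi>' :: "real \<Rightarrow> real"
  assumes h: "continuous_on {0..1} h"
    and \<phi>: "\<And>t. t \<in> {0..1} \<Longrightarrow> (\<phi> has_real_derivative \<phi>' t) (at t within {0..1})"
    and \<phi>': "\<phi>' absolutely_integrable_on {0..1}"
  shows "(\<lambda>t. imbalance h t * \<phi>' t) absolutely_integrable_on {0..1}"
    and "integral {0..1} (\<lambda>t. imbalance h t * \<phi>' t)
      = 2 * integral {0..1} (\<lambda>t. h t * \<phi> t) - (\<phi> 0 + \<phi> 1) * integral {0..1} h"
proof -
  have hi: "h integrable_on {0..1}"
    using h by (rule integrable_continuous_real)
  note c = continuous_on_imbalance[OF hi]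
  show abs: "(\<lambda>t. imbalance h t * \<phi>' t) absolutely_integrable_on {0..1}"
  proof (rule absolutely_integrable_bounded_measurable_product_real)
    show "imbalance h \<in> borel_measurable (lebesgue_on {0..1})"
      by (rule continuous_imp_measurable_on_sets_lebesgue[OF c]) auto
    show "bounded (imbalance h ` {0..1})"
      using c by (intro compact_imp_bounded compact_continuous_image) auto
  qed (use \<phi>' in auto)
  have "continuous_on {0..1} \<phi>"
    using \<phi> by (intro DERIV_continuous_on)
  then have "(\<lambda>t. h t * \<phi> t) integrable_on {0..1}"
    by (intro integrable_continuous_real continuous_intros h)
  then have "((\<lambda>t. 2 * (h t * \<phi> t)) has_integral 2 * integral {0..1} (\<lambda>t. h t * \<phi> t)) {0..1}"
    by (intro has_integral_mult_right integrable_integral)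
  moreover have "((\<lambda>t. imbalance h t * \<phi>' t - 2 * (h t * \<phi> t)) has_integral
      imbalance h 1 * \<phi> 1 - imbalance h 0 * \<phi> 0) {0..1}"
  proof (rule fundamental_theorem_of_calculus)
    fix t :: real assume t: "t \<in> {0..1}"
    show "((\<lambda>t. imbalance h t * \<phi> t) has_vector_derivative imbalance h t * \<phi>' t - 2 * (h t * \<phi> t))
        (at t within {0..1})"
      using DERIV_mult[OF has_real_derivative_imbalance[OF h t] \<phi>[OF t]]
      by (simp add: has_real_derivative_iff_has_vector_derivative algebra_simps)
  qed auto
  ultimately have "((\<lambda>t. imbalance h t * \<phi>' t - 2 * (h t * \<phi> t) + 2 * (h t * \<phi> t)) has_integral
      imbalance h 1 * \<phi> 1 - imbalance h 0 * \<phi> 0 + 2 * integral {0..1} (\<lambda>t. h t * \<phi> t)) {0..1}"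
    by (rule has_integral_add[rotated])
  then show "integral {0..1} (\<lambda>t. imbalance h t * \<phi>' t)
      = 2 * integral {0..1} (\<lambda>t. h t * \<phi> t) - (\<phi> 0 + \<phi> 1) * integral {0..1} h"
    by (simp add: integral_unique imbalance_def algebra_simps)
qed

section \<open>The inequalities for the original interval\<close>

lemma Lq_norm_on_finite:
  assumes g: "set_integrable lebesgue {a..b} g" and q: "0 < q" and fin: "Lq_norm_on q a b g \<noteq> \<infinity>"
  obtains J where "0 \<le> J" "((\<lambda>x. \<bar>g x\<bar> powr q) has_integral J) {a..b}"
    "Lq_norm_on q a b g = ennreal (J powr (1 / q))"
proof -
  define N where "N = (\<integral>\<^sup>+x\<in>{a..b}. ennreal (\<bar>g x\<bar> powr q) \<partial>lebesgue)"
  have N: "N \<noteq> \<infinity>" "Lq_norm_on q a b g = ennreal (enn2real N powr (1 / q))"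
    using fin by (auto simp: Lq_norm_on_def N_def Let_def split: if_splits)
  let ?f = "\<lambda>x. \<bar>indicator {a..b} x * g x\<bar> powr q"
  have "(?f has_integral enn2real N) UNIV"
  proof (subst has_integral_iff_nn_integral_lebesgue, simp, intro conjI)
    have "(\<lambda>x. indicator {a..b} x * g x) \<in> borel_measurable lebesgue"
      using borel_measurable_integrable[OF g[unfolded set_integrable_def]] by simp
    then have "?f \<in> borel_measurable lebesgue"
      by measurable
    then show "?f \<in> borel_measurable lebesgue" .
    have "(\<integral>\<^sup>+x. ennreal (?f x) \<partial>lebesgue) = N"
      unfolding N_def using q by (intro nn_integral_cong) (simp split: split_indicator)
    then show "(\<integral>\<^sup>+x. ennreal (?f x) \<partial>lebesgue) = ennreal (enn2real N)"
      using N(1) by (simp add: less_top)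
  qed auto
  moreover have "?f = (\<lambda>x. if x \<in> {a..b} then \<bar>g x\<bar> powr q else 0)"
    using q by (auto simp: fun_eq_iff)
  ultimately have "((\<lambda>x. \<bar>g x\<bar> powr q) has_integral enn2real N) {a..b}"
    by (simp only: has_integral_restrict_UNIV)
  then show ?thesis
    using that[of "enn2real N"] N(2) by simp
qed

theorem lemma2p1:
  fixes I :: "real set" and a b :: real and g :: "real \<Rightarrow> real"
  assumes "is_interval I"
    and "a \<in> interior I" and "b \<in> interior I" and "a < b"
    and "set_integrable lebesgue {a..b} g"
  shows
    "(symmetric_mid a b g \<longrightarrow>
        (\<forall>t\<in>{0..1/2}. M_fun g a b t =
            2 * (LINT s:{t..1/2}|lebesgue. g (s * a + (1 - s) * b))) \<and>
        (\<forall>t\<in>{1/2..1}. M_fun g a b t =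
            - 2 * (LINT s:{1/2..t}|lebesgue. g (s * a + (1 - s) * b)))) \<and>
     (symmetric_mid a b g \<longrightarrow>
        (\<forall>t\<in>{0..1}. M_fun g a b t + M_fun g a b (1 - t) = 0)) \<and>
     (symmetric_mid a b g \<and> (\<forall>x\<in>{a..b}. 0 \<le> g x) \<longrightarrow>
        (\<forall>t\<in>{0..1/2}. 0 \<le> M_fun g a b t) \<and>
        (\<forall>t\<in>{1/2..1}. M_fun g a b t \<le> 0)) \<and>
     (ennreal (LINT t:{0..1}|lebesgue. \<bar>M_fun g a b t\<bar>) \<le> ennreal (1/2) * sup_norm_on a b g \<and>
      (\<forall>p q :: real. 1 < p \<and> 1 < q \<and> 1 / p + 1 / q = 1 \<longrightarrow>
         ennreal (LINT t:{0..1}|lebesgue. \<bar>M_fun g a b t\<bar>)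
           \<le> 2 * (ennreal ((b - a) powr (- 1 / q)) * Lq_norm_on q a b g) *
             ennreal (LINT t:{0..1}|lebesgue. \<bar>t - 1/2\<bar> powr (1 / p)) \<and>
         (1 \<le> b - a \<longrightarrow>
           ennreal (LINT t:{0..1}|lebesgue. \<bar>M_fun g a b t\<bar>)
             \<le> 2 * Lq_norm_on q a b g *
               ennreal (LINT t:{0..1}|lebesgue. \<bar>t - 1/2\<bar> powr (1 / p))))) \<and>
     (\<forall>f :: real \<Rightarrow> real.
        f differentiable_on interior I \<and>
        g differentiable_on {a..b} \<and> (\<forall>x\<in>{a..b}. 0 \<le> g x) \<and>
        set_integrable lebesgue {a..b} (deriv f) \<longrightarrow>
        1 / (b - a) *
          ((f a + f b) / 2 * (LINT x:{a..b}|lebesgue. g x) - (LINT x:{a..b}|lebesgue. f x * g x)) =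
        (b - a) / 2 *
          (LINT t:{0..1}|lebesgue. M_fun g a b t * deriv f (t * a + (1 - t) * b)))"
proof -
  define h where "h = (\<lambda>s. g (s * a + (1 - s) * b))"
  have ab: "a < b" and g: "g absolutely_integrable_on {a..b}"
    using assms by auto
  have h: "h absolutely_integrable_on {0..1}"
    unfolding h_def by (rule absolutely_integrable_unit_segment[OF ab g])
  then have hi: "h integrable_on {0..1}"
    by (simp add: absolutely_integrable_on_def)
  have LINT_h: "(LINT s:{c..d}|lebesgue. g (s * a + (1 - s) * b)) = integral {c..d} h"
    if "0 \<le> c" "d \<le> 1" for c d
    using set_lebesgue_integral_eq_integral(2)[OF absolutely_integrable_on_subinterval[OF h, of c d]] that
    by (simp add: h_def)
  have M: "M_fun g a b t = imbalance h t" if "t \<in> {0..1}" for t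
    using that by (simp add: M_fun_def imbalance_def LINT_h)
  have h_int: "integral {0..1} h = integral {a..b} g / (b - a)"
    unfolding h_def
    using has_integral_unit_segment[OF ab integrable_integral] set_lebesgue_integral_eq_integral(1)[OF g]
    by (blast intro: integral_unique)
  have seg: "s * a + (1 - s) * b \<in> {a..b}" if "s \<in> {0..1}" for s
    using convexD_alt[of "{a..b}" b a s] that ab by (simp add: algebra_simps)
  have sym: "h (1 - s) = h s" if "symmetric_mid a b g" "s \<in> {0..1}" for s
  proof -
    have "g (s * a + (1 - s) * b) = g (a + b - (s * a + (1 - s) * b))"
      using that(1) seg[OF that(2)] unfolding symmetric_mid_def by blast
    then show ?thesis
      by (simp add: h_def algebra_simps)
  qed

  have i: "(\<forall>t\<in>{0..1/2}. M_fun g a b t = 2 * (LINT s:{t..1/2}|lebesgue. g (s * a + (1 - s) * b))) \<and>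
        (\<forall>t\<in>{1/2..1}. M_fun g a b t = - 2 * (LINT s:{1/2..t}|lebesgue. g (s * a + (1 - s) * b)))"
    if s: "symmetric_mid a b g"
    using imbalance_symmetric(1,2)[OF hi sym[OF s]] by (auto simp: M LINT_h)
  have ii: "\<forall>t\<in>{0..1}. M_fun g a b t + M_fun g a b (1 - t) = 0" if s: "symmetric_mid a b g"
    using imbalance_symmetric(3)[OF hi sym[OF s]] by (auto simp: M)
  have iii: "(\<forall>t\<in>{0..1/2}. 0 \<le> M_fun g a b t) \<and> (\<forall>t\<in>{1/2..1}. M_fun g a b t \<le> 0)"
    if s: "symmetric_mid a b g" and pos: "\<forall>x\<in>{a..b}. 0 \<le> g x"
  proof -
    have "0 \<le> integral {c..d} h" if "0 \<le> c" "d \<le> 1" for c d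
    proof (rule integral_nonneg)
      show "h integrable_on {c..d}"
        by (rule integrable_on_subinterval[OF hi]) (use that in auto)
      show "0 \<le> h s" if "s \<in> {c..d}" for s
        using seg[of s] pos that \<open>0 \<le> c\<close> \<open>d \<le> 1\<close> by (simp add: h_def)
    qed
    then show ?thesis
      using imbalance_symmetric(1,2)[OF hi sym[OF s]] by (auto simp: M)
  qed

  have "(\<lambda>t. \<bar>imbalance h t\<bar>) absolutely_integrable_on {0..1}"
    by (intro absolutely_integrable_continuous_real continuous_intros continuous_on_imbalance hi)
  from set_lebesgue_integral_eq_integral(2)[OF this]
  have LINT_M: "(LINT t:{0..1}|lebesgue. \<bar>M_fun g a b t\<bar>) = integral {0..1} (\<lambda>t. \<bar>imbalance h t\<bar>)"
    by (subst set_lebesgue_integral_cong[where g = "\<lambda>t. \<bar>imbalance h t\<bar>"]) (auto simp: M)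
  have iv_sup: "ennreal (LINT t:{0..1}|lebesgue. \<bar>M_fun g a b t\<bar>) \<le> ennreal (1/2) * sup_norm_on a b g"
  proof (cases "sup_norm_on a b g = \<infinity>")
    case True
    then show ?thesis by (simp add: ennreal_mult_top)
  next
    case False
    define C where "C = enn2real (sup_norm_on a b g)"
    have C: "sup_norm_on a b g = ennreal C" "0 \<le> C"
      using False by (auto simp: C_def less_top)
    have "\<bar>h s\<bar> \<le> C" if "s \<in> {0..1}" for s
    proof -
      have "ennreal \<bar>h s\<bar> \<le> sup_norm_on a b g"
        unfolding sup_norm_on_def h_def by (rule SUP_upper[OF seg[OF that]])
      then show ?thesis using C by simp
    qed
    then have "integral {0..1} (\<lambda>t. \<bar>imbalance h t\<bar>) \<le> 1 / 2 * C"
      by (rule integral_abs_imbalance_le_sup[OF h])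
    then show ?thesis
      unfolding LINT_M C(1) using C(2) by (metis ennreal_leI ennreal_mult'' order.trans)
  qed

  have iv_Lq: "ennreal (LINT t:{0..1}|lebesgue. \<bar>M_fun g a b t\<bar>)
           \<le> 2 * (ennreal ((b - a) powr (- 1 / q)) * Lq_norm_on q a b g) *
             ennreal (LINT t:{0..1}|lebesgue. \<bar>t - 1/2\<bar> powr (1 / p))"
    if pq: "1 < p" "1 < q" "1 / p + 1 / q = 1" for p q
  proof -
    define K where "K = integral {0..1} (\<lambda>t::real. \<bar>t - 1/2\<bar> powr (1 / p))"
    have "K = (1 / 2) powr (1 / p) / (1 / p + 1)"
      unfolding K_def using pq by (intro integral_unique has_integral_abs_mid_powr) auto
    then have K: "0 < K" using pq by (simp add: add_pos_pos)
    have "(\<lambda>t::real. \<bar>t - 1/2\<bar> powr (1 / p)) absolutely_integrable_on {0..1}"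
      using pq by (intro absolutely_integrable_continuous_real continuous_on_powr' continuous_intros) auto
    then have LINT_K: "(LINT t:{0..1}|lebesgue. \<bar>t - 1/2\<bar> powr (1 / p)) = K"
      by (simp add: K_def set_lebesgue_integral_eq_integral(2))
    show ?thesis
    proof (cases "Lq_norm_on q a b g = \<infinity>")
      case True
      \<comment> \<open>The other factors do not vanish, so the right-hand side is infinite.\<close>
      then show ?thesis
        using K ab by (simp add: LINT_K ennreal_mult_top ennreal_top_mult)
    next
      case False
      then obtain J where J: "0 \<le> J" "((\<lambda>x. \<bar>g x\<bar> powr q) has_integral J) {a..b}"
          "Lq_norm_on q a b g = ennreal (J powr (1 / q))"
        using Lq_norm_on_finite[OF g] pq by (metis less_trans zero_less_one)
      have "((\<lambda>s. \<bar>h s\<bar> powr q) has_integral J / (b - a)) {0..1}"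
        unfolding h_def by (rule has_integral_unit_segment[OF ab J(2)])
      then have "integral {0..1} (\<lambda>t. \<bar>imbalance h t\<bar>) \<le> 2 * (J / (b - a)) powr (1 / q) * K"
        unfolding K_def by (rule integral_abs_imbalance_le_Lq[OF h pq])
      also have "(J / (b - a)) powr (1 / q) = (b - a) powr (- 1 / q) * J powr (1 / q)"
        using J(1) ab by (simp add: powr_divide powr_minus field_simps)
      finally have "ennreal (integral {0..1} (\<lambda>t. \<bar>imbalance h t\<bar>))
          \<le> ennreal (2 * ((b - a) powr (- 1 / q) * J powr (1 / q)) * K)"
        by (rule ennreal_leI)
      also have "\<dots> = 2 * (ennreal ((b - a) powr (- 1 / q)) * ennreal (J powr (1 / q))) * ennreal K"
        using K by (simp add: ennreal_mult)
      finally show ?thesis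
        unfolding LINT_M LINT_K J(3) .
    qed
  qed
  have iv_Lq': "ennreal (LINT t:{0..1}|lebesgue. \<bar>M_fun g a b t\<bar>)
           \<le> 2 * Lq_norm_on q a b g * ennreal (LINT t:{0..1}|lebesgue. \<bar>t - 1/2\<bar> powr (1 / p))"
    if pq: "1 < p" "1 < q" "1 / p + 1 / q = 1" and len: "1 \<le> b - a" for p q
  proof -
    have "(b - a) powr (- 1 / q) \<le> (b - a) powr 0"
      using pq len by (intro powr_mono) auto
    then have "ennreal ((b - a) powr (- 1 / q)) \<le> 1"
      using len by simp
    then have "ennreal ((b - a) powr (- 1 / q)) * Lq_norm_on q a b g \<le> Lq_norm_on q a b g"
      using mult_right_mono[of _ 1 "Lq_norm_on q a b g"] by simp
    then show ?thesis
      by (intro order_trans[OF iv_Lq[OF pq]] mult_right_mono mult_left_mono) auto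
  qed

  have v: "1 / (b - a) *
          ((f a + f b) / 2 * (LINT x:{a..b}|lebesgue. g x) - (LINT x:{a..b}|lebesgue. f x * g x)) =
        (b - a) / 2 *
          (LINT t:{0..1}|lebesgue. M_fun g a b t * deriv f (t * a + (1 - t) * b))"
    if f: "f differentiable_on interior I" and g': "g differentiable_on {a..b}"
      and f': "set_integrable lebesgue {a..b} (deriv f)" for f :: "real \<Rightarrow> real"
  proof -
    have "convex (interior I)"
      using assms(1) by (simp add: is_interval_convex convex_interior)
    then have "{a..b} \<subseteq> interior I"
      using assms(2,3) ab closed_segment_subset[of a "interior I" b]
      by (simp add: closed_segment_eq_real_ivl)
    then have df: "(f has_real_derivative deriv f x) (at x)" if "x \<in> {a..b}" for x
      using f that differentiable_on_eq_differentiable_at[of "interior I" f]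
      by (auto simp: DERIV_deriv_iff_real_differentiable)
    define \<phi> where "\<phi> = (\<lambda>s. f (s * a + (1 - s) * b))"
    define \<phi>' where "\<phi>' = (\<lambda>s. deriv f (s * a + (1 - s) * b))"
    have d\<phi>: "(\<phi> has_real_derivative (a - b) * \<phi>' t) (at t within {0..1})" if "t \<in> {0..1}" for t
    proof -
      have "((\<lambda>s. s * a + (1 - s) * b) has_real_derivative a - b) (at t within {0..1})"
        by (auto intro!: derivative_eq_intros)
      from DERIV_chain2[where f = f, OF df[OF seg[OF that]] this] show ?thesis
        by (simp add: \<phi>_def \<phi>'_def mult.commute)
    qed
    have i\<phi>': "\<phi>' absolutely_integrable_on {0..1}"
      unfolding \<phi>'_def by (rule absolutely_integrable_unit_segment[OF ab f'])
    have gc: "continuous_on {a..b} g"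
      using g' by (rule differentiable_imp_continuous_on)
    have hc: "continuous_on {0..1} h"
      unfolding h_def by (rule continuous_on_compose2[OF gc]) (use seg in \<open>auto intro!: continuous_intros\<close>)
    have fc: "continuous_on {a..b} f"
      using df by (intro DERIV_continuous_on[of _ _ "deriv f"]) (auto intro: has_field_derivative_at_within)
    have fg: "(\<lambda>x. f x * g x) absolutely_integrable_on {a..b}"
      by (intro absolutely_integrable_continuous_real continuous_intros fc gc)
    have "((\<lambda>x. f x * g x) has_integral integral {a..b} (\<lambda>x. f x * g x)) {a..b}"
      using set_lebesgue_integral_eq_integral(1)[OF fg] by (rule integrable_integral)
    from has_integral_unit_segment[OF ab this]
    have h\<phi>: "integral {0..1} (\<lambda>t. h t * \<phi> t) = integral {a..b} (\<lambda>x. f x * g x) / (b - a)"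
      by (simp add: h_def \<phi>_def mult.commute integral_unique)
    have "(\<lambda>s. (a - b) * \<phi>' s) absolutely_integrable_on {0..1}"
      using i\<phi>' by simp
    note parts = integral_imbalance_by_parts[OF hc d\<phi> this]
    \<comment> \<open>The chain rule factor \<open>a - b\<close> is carried by the derivative of \<open>\<phi>\<close>; it is divided out again.\<close>
    have "(\<lambda>t. 1 / (a - b) * (imbalance h t * ((a - b) * \<phi>' t))) absolutely_integrable_on {0..1}"
      by (intro set_integrable_mult_right impI parts(1))
    then have "(\<lambda>t. imbalance h t * \<phi>' t) absolutely_integrable_on {0..1}"
      using ab by simp
    from set_lebesgue_integral_eq_integral(2)[OF this]
    have "(LINT t:{0..1}|lebesgue. M_fun g a b t * deriv f (t * a + (1 - t) * b))
        = integral {0..1} (\<lambda>t. imbalance h t * \<phi>' t)"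
      by (subst set_lebesgue_integral_cong[where g = "\<lambda>t. imbalance h t * \<phi>' t"]) (auto simp: M \<phi>'_def)
    moreover have "(a - b) * integral {0..1} (\<lambda>t. imbalance h t * \<phi>' t)
        = 2 * integral {0..1} (\<lambda>t. h t * \<phi> t) - (\<phi> 0 + \<phi> 1) * integral {0..1} h"
      using parts(2) by (simp add: mult.left_commute flip: integral_mult_right)
    ultimately have "(b - a) * (LINT t:{0..1}|lebesgue. M_fun g a b t * deriv f (t * a + (1 - t) * b))
        = (f a + f b) * (integral {a..b} g / (b - a)) - 2 * (integral {a..b} (\<lambda>x. f x * g x) / (b - a))"
      unfolding h\<phi> h_int by (simp add: \<phi>_def algebra_simps)
    moreover have rescale: "1 / L * (F / 2 * G - P) = (F * (G / L) - 2 * (P / L)) / 2"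
      if "L \<noteq> 0" for L F G P :: real
      using that by (simp add: field_simps)
    ultimately have "(b - a) / 2 * (LINT t:{0..1}|lebesgue. M_fun g a b t * deriv f (t * a + (1 - t) * b))
        = ((f a + f b) * (integral {a..b} g / (b - a)) - 2 * (integral {a..b} (\<lambda>x. f x * g x) / (b - a))) / 2"
      by simp
    then show ?thesis
      using rescale[of "b - a" "f a + f b" "integral {a..b} g" "integral {a..b} (\<lambda>x. f x * g x)"] ab
      by (simp only: set_lebesgue_integral_eq_integral(2)[OF g]
          set_lebesgue_integral_eq_integral(2)[OF fg])
  qed
  show ?thesis
    using i ii iii iv_sup iv_Lq iv_Lq' v by blast
qed

end
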